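(* Let $A\colon\mathbb{R}^+\to M(n,\mathbb{R})$ and $f\colon\mathbb{R}^+\times\mathbb{R}^n\to\mathbb{R}^n$ have the following properties. (P1) $A(t)$ is continuous and $\sup_{t\in\mathbb{R}^+}\|A(t)\|=M>0$. (P2) The system $\dot x=A(t)x$ is uniformly asymptotically stable, namely, there exist constants $K\ge 1$ and $\alpha>0$ such that its transition matrix $\Phi(t,s)$ satisfies $\|\Phi(t,s)\|\le Ke^{-\alpha(t-s)}$ for any $t\ge s\ge 0$. (P3) There are constants $\gamma,\mu$ such that for any $t\ge 0$ and any couple $(y,\bar y)\in\mathbb{R}^n\times\mathbb{R}^n$, $|f(t,y)-f(t,\bar y)|\le\gamma|y-\bar y|$ and $|f(t,y)|\le\mu$. If $$\frac{K\gamma}{\alpha}<1,$$ then the systems $\dot x=A(t)x$ and $\dot y=A(t)y+f(t,y)$ are $\mathbb{R}^+$-strongly topologically equivalent.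
   Context: $\mathbb{R}^+=[0,+\infty)$; $M(n,\mathbb{R})$ is the space of real $n\times n$ matrices; $\|\cdot\|$ and $|\cdot|$ denote a matrix norm and a vector norm respectively. The transition matrix $\Phi(t,s)$ of $\dot x=A(t)x$ is the solution of $\partial_t\Phi(t,s)=A(t)\Phi(t,s)$, $\Phi(s,s)=I$. The systems $\dot x=A(t)x$ and $\dot y=A(t)y+f(t,y)$ are $\mathbb{R}^+$-topologically equivalent if there exists a function $H\colon\mathbb{R}^+\times\mathbb{R}^n\to\mathbb{R}^n$ with the properties: (i) if $x(t)$ is a solution of $\dot x=A(t)x$, then $H[t,x(t)]$ is a solution of $\dot y=A(t)y+f(t,y)$; (ii) $H(t,u)-u$ is bounded in $\mathbb{R}^+\times\mathbb{R}^n$; (iii) for each fixed $t\in\mathbb{R}^+$, $u\mapsto H(t,u)$ is a homeomorphism of $\mathbb{R}^n$. In addition, the function $G(t,u)=H^{-1}(t,u)$ (the inverse in $u$ for each fixed $t$) has properties (ii)--(iii) and maps solutions of $\dot y=A(t)y+f(t,y)$ into solutions of $\dot x=A(t)x$. The systems are $\mathbb{R}^+$-strongly topologically equivalent if they are $\mathbb{R}^+$-topologically equivalent and $H$ is a uniform homeomorphism, namely, for any $\varepsilon>0$ there exists $\delta(\varepsilon)>0$ such that $|u-\tilde u|<\delta$ implies $|H(t,u)-H(t,\tilde u)|<\varepsilon$ and $|G(t,u)-G(t,\tilde u)|<\varepsilon$ for any $t\in\mathbb{R}^+$.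
   Formalization: The formal theorem also assumes that f is continuous on R+ × R^n (otherwise the perturbed system may have no solution) and that the matrix norm is compatible with the vector norm, |Bx| ≤ ‖B‖|x|. *)

theory Defs
  imports "HOL-Analysis.Analysis"
begin

text \<open>Norms are kept as explicit functions because the vector norm and the matrix norm are
  arbitrary; the class constant \<^const>\<open>norm\<close> on \<^typ>\<open>real^'n\<close> is the Euclidean one, and on
  \<^typ>\<open>real^'n^'n\<close> the Frobenius one. Nonnegativity follows from the three axioms.\<close>

definition is_norm :: "('a::real_vector \<Rightarrow> real) \<Rightarrow> bool" where
  "is_norm N \<longleftrightarrow>
     (\<forall>x. N x = 0 \<longleftrightarrow> x = 0) \<and>
     (\<forall>c x. N (c *\<^sub>R x) = \<bar>c\<bar> * N x) \<and>
     (\<forall>x y. N (x + y) \<le> N x + N y)"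

text \<open>Submultiplicativity is deliberately not demanded, so that operator norms and all other
  submultiplicative compatible norms are covered.\<close>

definition compatible_matrix_norm ::
    "(real^'n \<Rightarrow> real) \<Rightarrow> (real^'n^'n \<Rightarrow> real) \<Rightarrow> bool" where
  "compatible_matrix_norm vnorm mnorm \<longleftrightarrow>
     is_norm mnorm \<and> (\<forall>B x. vnorm (B *v x) \<le> mnorm B * vnorm x)"

text \<open>All functions of time are only considered on the half-line \<open>t \<ge> 0\<close>; at \<open>t = 0\<close> the
  derivative is one-sided.\<close>

definition solves_ode :: "(real \<Rightarrow> 'a::real_normed_vector) \<Rightarrow> (real \<Rightarrow> 'a \<Rightarrow> 'a) \<Rightarrow> bool" where
  "solves_ode x F \<longleftrightarrow>
     (\<forall>t\<ge>0. (x has_vector_derivative F t (x t)) (at t within {0..}))"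

definition transition_matrix ::
    "(real \<Rightarrow> real^'n^'n) \<Rightarrow> (real \<Rightarrow> real \<Rightarrow> real^'n^'n) \<Rightarrow> bool" where
  "transition_matrix A \<Phi> \<longleftrightarrow>
     (\<forall>s\<ge>0. solves_ode (\<lambda>t. \<Phi> t s) (\<lambda>t X. A t ** X) \<and> \<Phi> s s = mat 1)"

text \<open>\<open>H\<close> maps solutions of \<open>x' = F t x\<close> to solutions of \<open>y' = F' t y\<close>, and \<open>G t\<close> is the inverse
  of \<open>H t\<close> for each \<open>t \<ge> 0\<close>.\<close>

definition topological_equivalence ::
    "('a::real_normed_vector \<Rightarrow> real) \<Rightarrow> (real \<Rightarrow> 'a \<Rightarrow> 'a) \<Rightarrow> (real \<Rightarrow> 'a \<Rightarrow> 'a) \<Rightarrow>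
     (real \<Rightarrow> 'a \<Rightarrow> 'a) \<Rightarrow> (real \<Rightarrow> 'a \<Rightarrow> 'a) \<Rightarrow> bool" where
  "topological_equivalence vnorm F F' H G \<longleftrightarrow>
     (\<forall>x. solves_ode x F \<longrightarrow> solves_ode (\<lambda>t. H t (x t)) F') \<and>
     (\<forall>y. solves_ode y F' \<longrightarrow> solves_ode (\<lambda>t. G t (y t)) F) \<and>
     (\<exists>B. \<forall>t\<ge>0. \<forall>u. vnorm (H t u - u) \<le> B) \<and>
     (\<exists>B. \<forall>t\<ge>0. \<forall>u. vnorm (G t u - u) \<le> B) \<and>
     (\<forall>t\<ge>0. homeomorphism UNIV UNIV (H t) (G t))"

definition topologically_equivalent ::
    "('a::real_normed_vector \<Rightarrow> real) \<Rightarrow> (real \<Rightarrow> 'a \<Rightarrow> 'a) \<Rightarrow> (real \<Rightarrow> 'a \<Rightarrow> 'a) \<Rightarrow> bool" where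
  "topologically_equivalent vnorm F F' \<longleftrightarrow> (\<exists>H G. topological_equivalence vnorm F F' H G)"

definition strongly_topologically_equivalent ::
    "('a::real_normed_vector \<Rightarrow> real) \<Rightarrow> (real \<Rightarrow> 'a \<Rightarrow> 'a) \<Rightarrow> (real \<Rightarrow> 'a \<Rightarrow> 'a) \<Rightarrow> bool" where
  "strongly_topologically_equivalent vnorm F F' \<longleftrightarrow>
     (\<exists>H G. topological_equivalence vnorm F F' H G \<and>
        (\<forall>\<epsilon>>0. \<exists>\<delta>>0. \<forall>t\<ge>0. \<forall>u v. vnorm (u - v) < \<delta> \<longrightarrow>
            vnorm (H t u - H t v) < \<epsilon> \<and> vnorm (G t u - G t v) < \<epsilon>))"

end

theory Submission
  imports Defs
begin

text \<open>The equivalence pairs a solution \<open>x\<close> of the linear system with the solution \<open>y\<close> of the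
  perturbed system that has the same value at time \<open>0\<close>: \<open>H t u\<close> follows the linear flow from
  \<open>(t, u)\<close> back to time \<open>0\<close> and then the perturbed flow forward to time \<open>t\<close>, and \<open>G\<close> exchanges
  the two flows.  Both right-hand sides are globally Lipschitz, so the flows exist and are unique on
  the whole half-line (\<open>lipschitz_field_ivp\<close>, \<open>lipschitz_field_solution_unique\<close>); therefore \<open>H\<close> and
  \<open>G\<close> map solutions to solutions and are mutually inverse.

  Stability enters through variation of constants, \<open>d t = \<Phi> t s *v d s + \<integral>\<^sub>s\<^sup>t \<Phi> t r *v h r dr\<close> for a
  solution \<open>d\<close> of the linear system with forcing \<open>h\<close>.  It is used in two ways.  With
  \<open>d = y - x\<close> the forcing is bounded by \<open>\<mu>\<close> and \<open>d 0 = 0\<close>, so \<open>d\<close> never exceeds \<open>K * \<mu> / \<alpha>\<close>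
  (\<open>perturbed_solution_close\<close>); hence \<open>H\<close> and \<open>G\<close> stay near the identity.  With \<open>d\<close> the difference
  of two perturbed solutions the forcing is at most \<open>\<gamma>\<close> times \<open>d\<close>, and Gronwall's inequality gives
  decay at the rate \<open>\<alpha> - K * \<gamma>\<close>, which the smallness hypothesis makes positive
  (\<open>perturbed_solutions_contract\<close>).

  Uniform continuity (\<open>transfer_equicontinuous\<close>) balances this decay against growth in backward
  time.  Let \<open>u\<close> and \<open>v\<close> be close at time \<open>t\<close> and let \<open>s = max 0 (t - T)\<close>.  Going back a time at most
  \<open>T\<close>, the source solutions separate at most by the factor \<open>exp (L * T)\<close>.  At time \<open>s\<close> each target
  solution is within a fixed distance \<open>B\<close> of its source solution, and exactly on it if \<open>s = 0\<close>.  If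
  \<open>s > 0\<close>, the elapsed time is \<open>T\<close> and the contraction makes the contribution of \<open>B\<close> as small as
  desired; \<open>T\<close> is fixed first and \<open>\<delta>\<close> afterwards, both independently of \<open>t\<close>.  The argument is the same
  for \<open>H\<close> and \<open>G\<close>, since both flows contract.

  The rate must be computed in the given norm, in which \<open>K\<close> and \<open>\<gamma>\<close> are measured, whereas existence
  and backward growth tolerate any constants and are proved in the Euclidean norm; the equivalence
  of norms links the two.\<close>

section \<open>Arbitrary norms on Euclidean spaces\<close>

lemma is_norm_zero:
  assumes "is_norm N"
  shows "N 0 = 0"
  using assms by (simp add: is_norm_def)

lemma is_norm_nonneg:
  assumes "is_norm N"
  shows "0 \<le> N x"
proof -
  have "N (x + (-1) *\<^sub>R x) \<le> N x + N ((-1) *\<^sub>R x)" "N ((-1) *\<^sub>R x) = \<bar>-1\<bar> * N x" "N 0 = 0"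
    using assms unfolding is_norm_def by blast+
  then show ?thesis by simp
qed

lemma is_norm_minus_commute:
  assumes "is_norm N"
  shows "N (x - y) = N (y - x)"
proof -
  have "N ((-1) *\<^sub>R (y - x)) = \<bar>-1\<bar> * N (y - x)"
    using assms unfolding is_norm_def by blast
  then show ?thesis by simp
qed

lemma is_norm_diff_le:
  assumes "is_norm N"
  shows "N x \<le> N y + N (x - y)"
proof -
  have "N (y + (x - y)) \<le> N y + N (x - y)"
    using assms unfolding is_norm_def by blast
  then show ?thesis by simp
qed

lemma is_norm_triangle:
  assumes "is_norm N"
  shows "N (x + y) \<le> N x + N y"
  using assms unfolding is_norm_def by blast

lemma is_norm_upper_bound:
  fixes N :: "'a::euclidean_space \<Rightarrow> real"
  assumes "is_norm N"
  obtains C where "C > 0" "\<And>x. N x \<le> C * norm x"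
proof
  let ?C = "1 + (\<Sum>b\<in>Basis. N b)"
  note nn = is_norm_nonneg[OF assms]
  show "?C > 0" using nn by (simp add: add_pos_nonneg sum_nonneg)
  fix x :: 'a
  have sum_le: "N (sum g S) \<le> (\<Sum>i\<in>S. N (g i))" if "finite S" for g :: "'a \<Rightarrow> 'a" and S
    using that
  proof (induction S)
    case empty
    then show ?case using is_norm_zero[OF assms] by simp
  next
    case (insert i S)
    then show ?case using is_norm_triangle[OF assms, of "g i" "sum g S"] by simp
  qed
  have "N x = N (\<Sum>b\<in>Basis. (x \<bullet> b) *\<^sub>R b)" by (simp add: euclidean_representation)
  also have "\<dots> \<le> (\<Sum>b\<in>Basis. N ((x \<bullet> b) *\<^sub>R b))" by (rule sum_le) simp
  also have "\<dots> = (\<Sum>b\<in>Basis. \<bar>x \<bullet> b\<bar> * N b)" using assms by (simp add: is_norm_def)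
  also have "\<dots> \<le> (\<Sum>b\<in>Basis. norm x * N b)"
    by (intro sum_mono mult_right_mono Basis_le_norm nn)
  also have "\<dots> \<le> ?C * norm x" by (simp add: sum_distrib_left algebra_simps)
  finally show "N x \<le> ?C * norm x" .
qed

lemma continuous_on_is_norm:
  fixes N :: "'a::euclidean_space \<Rightarrow> real"
  assumes "is_norm N"
  shows "continuous_on S N"
proof -
  obtain C where C: "C > 0" "\<And>x. N x \<le> C * norm x" using is_norm_upper_bound[OF assms] by blast
  have "\<bar>N x - N y\<bar> \<le> C * dist x y" for x y
    using is_norm_diff_le[OF assms, of x y] is_norm_diff_le[OF assms, of y x]
      is_norm_minus_commute[OF assms, of x y] C(2)[of "x - y"]
    by (simp add: dist_norm)
  then show ?thesis
    by (intro lipschitz_on_continuous_on[of C] lipschitz_onI) (use C in \<open>auto simp: dist_real_def\<close>)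
qed

text \<open>The lower constant is the minimum of \<open>N\<close> over the compact Euclidean unit sphere.\<close>

lemma is_norm_equivalent:
  fixes N :: "'a::euclidean_space \<Rightarrow> real"
  assumes N: "is_norm N"
  obtains c C where "c > 0" "C > 0" "\<And>x. c * norm x \<le> N x" "\<And>x. N x \<le> C * norm x"
proof -
  obtain C where C: "C > 0" "\<And>x. N x \<le> C * norm x" using is_norm_upper_bound[OF N] by blast
  have "compact (sphere (0::'a) 1)" "sphere (0::'a) 1 \<noteq> {}" by auto
  then obtain e where e: "norm e = 1" "\<And>x. norm x = 1 \<Longrightarrow> N e \<le> N x"
    using continuous_attains_inf[OF _ _ continuous_on_is_norm[OF N], of "sphere 0 1"]
    by (auto simp: dist_norm)
  have "N e \<noteq> 0" using N e(1) unfolding is_norm_def by force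
  then have pos: "N e > 0" using is_norm_nonneg[OF N, of e] by simp
  have low: "N e * norm x \<le> N x" for x
  proof (cases "x = 0")
    case True
    then show ?thesis using is_norm_zero[OF N] by simp
  next
    case False
    then have "N e \<le> N ((1 / norm x) *\<^sub>R x)" by (intro e) simp
    also have "\<dots> = \<bar>1 / norm x\<bar> * N x" using N unfolding is_norm_def by blast
    finally show ?thesis using False by (simp add: field_simps)
  qed
  show thesis using that[OF pos C(1) low C(2)] .
qed

text \<open>The dual norm is attained: a hyperplane separating \<open>x0\<close> from the open \<open>N\<close>-ball of radius
  \<open>N x0\<close>, suitably scaled, is a supporting functional.\<close>

lemma is_norm_supporting_functional:
  fixes N :: "'a::euclidean_space \<Rightarrow> real"
  assumes N: "is_norm N"
  obtains v where "v \<bullet> x0 = N x0" "\<And>x. v \<bullet> x \<le> N x"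
proof (cases "x0 = 0")
  case True
  have "N x0 = 0" using is_norm_zero[OF N] True by simp
  then show thesis using that[of 0] is_norm_nonneg[OF N] by simp
next
  case False
  note nn = is_norm_nonneg[OF N]
  have hom: "N (c *\<^sub>R x) = \<bar>c\<bar> * N x" for c x using N by (simp add: is_norm_def)
  have r: "N x0 > 0" using False N nn[of x0] by (auto simp: is_norm_def order_less_le)
  have "convex {x. N x < N x0}"
  proof (rule convexI)
    fix x y :: 'a and u v :: real
    assume *: "x \<in> {x. N x < N x0}" "y \<in> {x. N x < N x0}" "0 \<le> u" "0 \<le> v" "u + v = 1"
    have "N (u *\<^sub>R x + v *\<^sub>R y) \<le> u * N x + v * N y"
      using is_norm_triangle[OF N, of "u *\<^sub>R x" "v *\<^sub>R y"] * by (simp add: hom)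
    also have "\<dots> < N x0" using * by (intro convex_bound_lt) auto
    finally show "u *\<^sub>R x + v *\<^sub>R y \<in> {x. N x < N x0}" by simp
  qed
  moreover have "0 \<in> {x. N x < N x0}" using r is_norm_zero[OF N] by simp
  ultimately obtain a b where a: "a \<noteq> 0" and low: "\<And>x. N x < N x0 \<Longrightarrow> a \<bullet> x \<le> b" and up: "a \<bullet> x0 \<ge> b"
    using separating_hyperplane_sets[of "{x. N x < N x0}" "{x0}"] by force
  have sep: "a \<bullet> x \<le> a \<bullet> x0" if "N x < N x0" for x using low[OF that] up by simp
  have Na: "N a > 0" using a N nn[of a] by (auto simp: is_norm_def order_less_le)
  have "a \<bullet> ((N x0 / (2 * N a)) *\<^sub>R a) \<le> a \<bullet> x0"
    using Na r by (intro sep) (simp add: hom)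
  moreover have "a \<bullet> ((N x0 / (2 * N a)) *\<^sub>R a) > 0" using a Na r by simp
  ultimately have pos: "a \<bullet> x0 > 0" by simp
  have bound: "N x0 * (a \<bullet> x) \<le> N x * (a \<bullet> x0)" for x
  proof (cases "x = 0")
    case False
    then have Nx: "N x > 0" using N nn[of x] by (auto simp: is_norm_def order_less_le)
    show ?thesis
    proof (rule field_le_mult_one_interval)
      fix z :: real assume z: "0 < z" "z < 1"
      have "a \<bullet> ((z * N x0 / N x) *\<^sub>R x) \<le> a \<bullet> x0"
        using Nx z r by (intro sep) (simp add: hom)
      then show "z * (N x0 * (a \<bullet> x)) \<le> N x * (a \<bullet> x0)"
        using Nx by (simp add: field_simps)
    qed
  qed (use is_norm_zero[OF N] in simp)
  show thesis
  proof
    show "((N x0 / (a \<bullet> x0)) *\<^sub>R a) \<bullet> x0 = N x0" using pos by simp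
    show "((N x0 / (a \<bullet> x0)) *\<^sub>R a) \<bullet> x \<le> N x" for x
      using bound[of x] pos by (simp add: field_simps)
  qed
qed

section \<open>Differential and integral inequalities\<close>

lemma within_deriv_nonneg_imp_le:
  fixes g g' :: "real \<Rightarrow> real"
  assumes "a \<le> b"
    and deriv: "\<And>s. s \<in> {a..b} \<Longrightarrow> (g has_real_derivative g' s) (at s within {a..b})"
    and nonneg: "\<And>s. s \<in> {a..b} \<Longrightarrow> 0 \<le> g' s"
  shows "g a \<le> g b"
proof (rule DERIV_nonneg_imp_increasing_open[OF \<open>a \<le> b\<close>])
  fix s assume s: "a < s" "s < b"
  then have "(g has_real_derivative g' s) (at s)"
    using deriv[of s] at_within_Icc_at[of a s b] by simp
  then show "\<exists>y. DERIV g s :> y \<and> 0 \<le> y" using nonneg[of s] s by auto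
next
  show "continuous_on {a..b} g"
    using deriv by (rule DERIV_continuous_on)
qed

text \<open>Testing \<open>p\<close> against a functional that supports \<open>N\<close> at \<open>p b - p a\<close> reduces the mean value
  inequality for an arbitrary norm to monotonicity of a real function.\<close>

lemma is_norm_mean_value:
  fixes N :: "'a::euclidean_space \<Rightarrow> real"
  assumes N: "is_norm N" and "a \<le> b"
    and p: "\<And>s. s \<in> {a..b} \<Longrightarrow> (p has_vector_derivative p' s) (at s within {a..b})"
    and g: "\<And>s. s \<in> {a..b} \<Longrightarrow> (g has_real_derivative g' s) (at s within {a..b})"
    and le: "\<And>s. s \<in> {a..b} \<Longrightarrow> N (p' s) \<le> g' s"
  shows "N (p b - p a) \<le> g b - g a"
proof -
  obtain v where v: "v \<bullet> (p b - p a) = N (p b - p a)" "\<And>x. v \<bullet> x \<le> N x"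
    using is_norm_supporting_functional[OF N, of "p b - p a"] by blast
  have "g a - v \<bullet> p a \<le> g b - v \<bullet> p b"
  proof (rule within_deriv_nonneg_imp_le[OF \<open>a \<le> b\<close>])
    fix s assume s: "s \<in> {a..b}"
    have "((\<lambda>s. v \<bullet> p s) has_vector_derivative v \<bullet> p' s) (at s within {a..b})"
      by (rule bounded_linear.has_vector_derivative[OF bounded_linear_inner_right p[OF s]])
    then show "((\<lambda>s. g s - v \<bullet> p s) has_real_derivative g' s - v \<bullet> p' s) (at s within {a..b})"
      using g[OF s] by (intro DERIV_diff) (simp_all add: has_real_derivative_iff_has_vector_derivative)
    show "0 \<le> g' s - v \<bullet> p' s" using le[OF s] v(2)[of "p' s"] by simp
  qed
  then show ?thesis using v(1) by (simp add: inner_diff_right)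
qed

text \<open>Two solutions of a Lipschitz equation can separate, and approach each other, at most
  exponentially.  Both bounds come from one computation: \<open>\<sigma> * exp (\<sigma> * 2 * L * t) * (norm (d t))\<^sup>2\<close> is
  increasing for \<open>\<sigma> = 1\<close> and for \<open>\<sigma> = -1\<close>.\<close>

lemma norm_growth_two_sided:
  fixes d d' :: "real \<Rightarrow> 'a::real_inner"
  assumes "a \<le> b"
    and d: "\<And>s. s \<in> {a..b} \<Longrightarrow> (d has_vector_derivative d' s) (at s within {a..b})"
    and le: "\<And>s. s \<in> {a..b} \<Longrightarrow> norm (d' s) \<le> L * norm (d s)"
  shows "norm (d b) \<le> exp (L * (b - a)) * norm (d a)"
    and "norm (d a) \<le> exp (L * (b - a)) * norm (d b)"
proof -
  have deriv: "((\<lambda>s. \<sigma> * exp (\<sigma> * 2 * L * s) * (d s \<bullet> d s)) has_real_derivative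
      2 * exp (\<sigma> * 2 * L * s) * (L * (d s \<bullet> d s) + \<sigma> * (d s \<bullet> d' s))) (at s within {a..b})"
    if s: "s \<in> {a..b}" and \<sigma>: "\<sigma> * \<sigma> = 1" for s \<sigma>
  proof -
    have "((\<lambda>s. d s \<bullet> d s) has_vector_derivative (d s \<bullet> d' s + d' s \<bullet> d s)) (at s within {a..b})"
      by (rule bounded_bilinear.has_vector_derivative[OF bounded_bilinear_inner d[OF s] d[OF s]])
    then have *: "((\<lambda>s. d s \<bullet> d s) has_real_derivative 2 * (d s \<bullet> d' s)) (at s within {a..b})"
      by (simp add: has_real_derivative_iff_has_vector_derivative inner_commute)
    have "((\<lambda>s. \<sigma> * exp (\<sigma> * 2 * L * s) * (d s \<bullet> d s)) has_real_derivative
        2 * exp (\<sigma> * 2 * L * s) * ((\<sigma> * \<sigma>) * L * (d s \<bullet> d s) + \<sigma> * (d s \<bullet> d' s))) (at s within {a..b})"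
      by (rule derivative_eq_intros * refl)+ (simp add: algebra_simps)
    then show ?thesis by (simp add: \<sigma>)
  qed
  have inner: "\<bar>d s \<bullet> d' s\<bar> \<le> L * (d s \<bullet> d s)" if "s \<in> {a..b}" for s
  proof -
    have "\<bar>d s \<bullet> d' s\<bar> \<le> norm (d s) * norm (d' s)" by (rule Cauchy_Schwarz_ineq2)
    also have "\<dots> \<le> norm (d s) * (L * norm (d s))" using le[OF that] by (simp add: mult_left_mono)
    finally show ?thesis by (simp add: dot_square_norm power2_eq_square algebra_simps)
  qed
  have mono: "\<sigma> * exp (\<sigma> * 2 * L * a) * (d a \<bullet> d a) \<le> \<sigma> * exp (\<sigma> * 2 * L * b) * (d b \<bullet> d b)"
    if \<sigma>: "\<sigma> = 1 \<or> \<sigma> = -1" for \<sigma>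
  proof (rule within_deriv_nonneg_imp_le[OF \<open>a \<le> b\<close> deriv])
    show "\<sigma> * \<sigma> = 1" using \<sigma> by auto
    show "0 \<le> 2 * exp (\<sigma> * 2 * L * s) * (L * (d s \<bullet> d s) + \<sigma> * (d s \<bullet> d' s))" if "s \<in> {a..b}" for s
      using inner[OF that] \<sigma> by (intro mult_nonneg_nonneg) auto
  qed
  from mono[of 1] mono[of "-1"] have 1: "exp (2 * (L * a)) * (norm (d a))\<^sup>2 \<le> exp (2 * (L * b)) * (norm (d b))\<^sup>2"
    and 2: "exp (- 2 * (L * b)) * (norm (d b))\<^sup>2 \<le> exp (- 2 * (L * a)) * (norm (d a))\<^sup>2"
    by (simp_all add: dot_square_norm algebra_simps)
  have *: "norm u \<le> exp (L * (b - a)) * norm w"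
    if "exp r * (norm u)\<^sup>2 \<le> exp q * (norm w)\<^sup>2" "q - r = 2 * (L * (b - a))" for u w :: 'a and q r
  proof (rule power2_le_imp_le)
    have "(norm u)\<^sup>2 \<le> exp (q - r) * (norm w)\<^sup>2"
      using that(1) by (simp add: exp_diff field_simps)
    also have "exp (q - r) = (exp (L * (b - a)))\<^sup>2"
      using that(2) by (simp add: exp_double)
    finally show "(norm u)\<^sup>2 \<le> (exp (L * (b - a)) * norm w)\<^sup>2" by (simp add: power_mult_distrib)
  qed simp
  show "norm (d b) \<le> exp (L * (b - a)) * norm (d a)"
    by (rule *[OF 2]) (simp add: algebra_simps)
  show "norm (d a) \<le> exp (L * (b - a)) * norm (d b)"
    by (rule *[OF 1]) (simp add: algebra_simps)
qed

text \<open>The right-hand side of the hypothesis, divided by \<open>exp (k * (t - a))\<close>, is decreasing in \<open>t\<close>.\<close>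

lemma gronwall_integral:
  fixes u :: "real \<Rightarrow> real"
  assumes "a \<le> b" and u: "continuous_on {a..b} u" and "0 \<le> k"
    and le: "\<And>t. t \<in> {a..b} \<Longrightarrow> u t \<le> c + k * integral {a..t} u"
  shows "u b \<le> c * exp (k * (b - a))"
proof -
  define U where "U t = c + k * integral {a..t} u" for t
  have "- exp (- k * (a - a)) * U a \<le> - exp (- k * (b - a)) * U b"
  proof (rule within_deriv_nonneg_imp_le[OF \<open>a \<le> b\<close>])
    fix s assume s: "s \<in> {a..b}"
    have "((\<lambda>t. integral {a..t} u) has_real_derivative u s) (at s within {a..b})"
      using integral_has_vector_derivative[OF u s] by (simp add: has_real_derivative_iff_has_vector_derivative)
    then have U: "(U has_real_derivative k * u s) (at s within {a..b})"
      unfolding U_def by (auto intro!: derivative_eq_intros)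
    show "((\<lambda>t. - exp (- k * (t - a)) * U t) has_real_derivative
        k * exp (- k * (s - a)) * (U s - u s)) (at s within {a..b})"
      by (rule derivative_eq_intros U refl)+ (simp add: algebra_simps)
    show "0 \<le> k * exp (- k * (s - a)) * (U s - u s)"
      using le[OF s] \<open>0 \<le> k\<close> by (simp add: U_def)
  qed
  then have "exp (- k * (b - a)) * U b \<le> c" by (simp add: U_def)
  then have "exp (k * (b - a)) * (exp (- k * (b - a)) * U b) \<le> exp (k * (b - a)) * c"
    by (intro mult_left_mono) auto
  then have "U b \<le> c * exp (k * (b - a))"
    by (simp add: mult.assoc[symmetric] mult.commute[of c] flip: exp_add)
  then show ?thesis using le[of b] \<open>a \<le> b\<close> by (simp add: U_def)
qed

section \<open>Globally Lipschitz differential equations on the half-line\<close>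

text \<open>A uniform bound on \<open>F t 0\<close> limits the growth of \<open>F t y\<close> to an affine function of \<open>norm y\<close> uniformly
  in time; this is what keeps solutions inside an exponentially weighted space of bounded functions.\<close>

definition lipschitz_field :: "real \<Rightarrow> (real \<Rightarrow> 'a::euclidean_space \<Rightarrow> 'a) \<Rightarrow> bool" where
  "lipschitz_field L F \<longleftrightarrow>
     0 < L \<and>
     continuous_on ({0..} \<times> UNIV) (\<lambda>(t, y). F t y) \<and>
     (\<forall>t\<ge>0. \<forall>y y'. norm (F t y - F t y') \<le> L * norm (y - y')) \<and>
     (\<exists>m. \<forall>t\<ge>0. norm (F t 0) \<le> m)"

lemma lipschitz_field_continuous_compose:
  assumes "lipschitz_field L F" "continuous_on S g" "continuous_on S y" "\<And>s. s \<in> S \<Longrightarrow> 0 \<le> g s"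
  shows "continuous_on S (\<lambda>s. F (g s) (y s))"
proof -
  have "continuous_on ({0..} \<times> UNIV) (\<lambda>(t, y). F t y)"
    using assms(1) by (simp add: lipschitz_field_def)
  moreover have "continuous_on S (\<lambda>s. (g s, y s))"
    using assms(2,3) by (rule continuous_on_Pair)
  ultimately have "continuous_on S (\<lambda>s. (\<lambda>(t, y). F t y) (g s, y s))"
    by (rule continuous_on_compose2) (use assms(4) in auto)
  then show ?thesis by simp
qed

lemma integral_has_vector_derivative_half_line:
  fixes h :: "real \<Rightarrow> 'a::banach"
  assumes "continuous_on {a..} h" "a \<le> t"
  shows "((\<lambda>t. integral {a..t} h) has_vector_derivative h t) (at t within {a..})"
proof -
  have "((\<lambda>t. integral {a..t} h) has_vector_derivative h t) (at t within {a..t + 1})"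
    using assms(2) by (intro integral_has_vector_derivative continuous_on_subset[OF assms(1)]) auto
  moreover have "at t within {a..t + 1} = at t within {a..}"
    by (rule at_within_nhd[of t "{..<t + 1}"]) (use assms in auto)
  ultimately show ?thesis by simp
qed

lemma norm_integral_le_exp:
  fixes h :: "real \<Rightarrow> 'a::banach"
  assumes "continuous_on {0..t} h" "0 < l" "0 \<le> c" "0 \<le> t"
    and le: "\<And>s. 0 \<le> s \<Longrightarrow> s \<le> t \<Longrightarrow> norm (h s) \<le> c * exp (l * s)"
  shows "norm (integral {0..t} h) \<le> c / l * exp (l * t)"
proof -
  have "((\<lambda>s. c * exp (l * s)) has_integral (c / l * exp (l * t) - c / l * exp (l * 0))) {0..t}"
    using assms(2,4)
    by (intro fundamental_theorem_of_calculus)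
      (auto intro!: derivative_eq_intros simp: has_real_derivative_iff_has_vector_derivative[symmetric])
  then have int: "(\<lambda>s. c * exp (l * s)) integrable_on {0..t}"
    "integral {0..t} (\<lambda>s. c * exp (l * s)) = c / l * exp (l * t) - c / l"
    by (simp_all add: has_integral_iff)
  have "norm (integral {0..t} h) \<le> integral {0..t} (\<lambda>s. c * exp (l * s))"
    using le
    by (intro integral_norm_bound_integral int(1) integrable_continuous_real[OF assms(1)]) simp
  also have "\<dots> \<le> c / l * exp (l * t)" using int(2) assms(2,3) by simp
  finally show ?thesis .
qed

text \<open>Picard's integral operator, written for \<open>z t = exp (- 2 * L * t) *\<^sub>R y t\<close>.  In this weighted
  variable it maps bounded continuous functions to bounded continuous functions and contracts with
  factor \<open>L / (2 * L)\<close> over the entire half-line, so a single application of Banach's fixed point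
  theorem gives a global solution and nothing has to be continued.  Times are clamped by \<open>max 0\<close>
  because the function space consists of functions on all reals.\<close>

lemma lipschitz_field_ivp_forward:
  fixes F :: "real \<Rightarrow> 'a::euclidean_space \<Rightarrow> 'a"
  assumes F: "lipschitz_field L F"
  obtains y where "solves_ode y F" "y 0 = v"
proof -
  have L: "0 < L" and Lip: "\<And>t y y'. 0 \<le> t \<Longrightarrow> norm (F t y - F t y') \<le> L * norm (y - y')"
    using F by (auto simp: lipschitz_field_def)
  obtain m where m: "\<And>t. 0 \<le> t \<Longrightarrow> norm (F t 0) \<le> m"
    using F by (auto simp: lipschitz_field_def)
  then have m0: "0 \<le> m" using norm_ge_zero order_trans by blast
  define g :: "(real \<Rightarrow>\<^sub>C 'a) \<Rightarrow> real \<Rightarrow> 'a"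
    where "g z s = F s (exp (2 * L * s) *\<^sub>R z s)" for z s
  define J where "J z t = integral {0..t} (g z)" for z t
  define P where "P z t = exp (- 2 * L * max 0 t) *\<^sub>R (v + J z (max 0 t))" for z t
  have g_cont: "continuous_on {0..} (g z)" for z
    unfolding g_def
    by (intro lipschitz_field_continuous_compose[OF F] continuous_intros continuous_on_apply_bcontfun) auto
  have J_deriv: "(J z has_vector_derivative g z t) (at t within {0..})" if "0 \<le> t" for z t
    unfolding J_def by (rule integral_has_vector_derivative_half_line[OF g_cont that])
  have g_bound: "norm (g z s) \<le> (m + L * norm z) * exp (2 * L * s)" if "0 \<le> s" for z s
  proof -
    have "norm (g z s) \<le> norm (F s 0) + norm (g z s - F s 0)" by (rule norm_triangle_sub)
    also have "\<dots> \<le> m + L * (exp (2 * L * s) * norm (z s))"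
      using m[OF that] Lip[OF that, of "exp (2 * L * s) *\<^sub>R z s" 0] by (simp add: g_def)
    also have "\<dots> \<le> m * exp (2 * L * s) + L * (exp (2 * L * s) * norm z)"
      using m0 L that norm_bounded[of z s] by (intro add_mono mult_left_mono) (auto simp: mult_le_cancel_left1)
    finally show ?thesis by (simp add: algebra_simps)
  qed
  have P_cont: "continuous_on UNIV (P z)" for z
  proof -
    have "continuous_on {0..} (J z)"
      by (rule continuous_on_vector_derivative) (use J_deriv in auto)
    then have "continuous_on UNIV (\<lambda>t. J z (max 0 t))"
      by (rule continuous_on_compose2) (auto intro!: continuous_intros)
    then show ?thesis unfolding P_def by (intro continuous_intros)
  qed
  have P_bound: "norm (P z t) \<le> norm v + (m + L * norm z) / (2 * L)" for z t
  proof -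
    let ?t = "max 0 t"
    have "norm (J z ?t) \<le> (m + L * norm z) / (2 * L) * exp (2 * L * ?t)"
      unfolding J_def using L m0 g_bound
      by (intro norm_integral_le_exp continuous_on_subset[OF g_cont]) auto
    then have "norm (v + J z ?t) \<le> norm v * exp (2 * L * ?t) + (m + L * norm z) / (2 * L) * exp (2 * L * ?t)"
      using L by (intro norm_triangle_mono) (auto simp: mult_le_cancel_left1)
    then have "norm (v + J z ?t) / exp (2 * L * ?t) \<le> norm v + (m + L * norm z) / (2 * L)"
      by (simp only: pos_divide_le_eq exp_gt_zero distrib_right)
    moreover have "norm (P z t) = norm (v + J z ?t) / exp (2 * L * ?t)"
      unfolding P_def norm_scaleR by (simp add: exp_minus inverse_eq_divide)
    ultimately show ?thesis by (simp only:)
  qed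
  have P_bcontfun: "P z \<in> bcontfun" for z
    using P_cont P_bound by (rule bcontfun_normI)
  have contraction: "dist (Bcontfun (P z)) (Bcontfun (P w)) \<le> 1 / 2 * dist z w" for z w
  proof (rule dist_bound)
    fix t :: real
    let ?t = "max 0 t"
    have "norm (g z s - g w s) \<le> L * dist z w * exp (2 * L * s)" if "0 \<le> s" for s
    proof -
      have "norm (g z s - g w s) \<le> L * (exp (2 * L * s) * norm (z s - w s))"
        using Lip[OF that, of "exp (2 * L * s) *\<^sub>R z s" "exp (2 * L * s) *\<^sub>R w s"]
        by (simp add: g_def flip: scaleR_diff_right)
      also have "\<dots> \<le> L * (exp (2 * L * s) * dist z w)"
        using L dist_bounded[of z s w] by (simp add: dist_norm)
      finally show ?thesis by (simp add: algebra_simps)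
    qed
    then have "norm (integral {0..?t} (\<lambda>s. g z s - g w s)) \<le> L * dist z w / (2 * L) * exp (2 * L * ?t)"
      using L
      by (intro norm_integral_le_exp continuous_on_diff continuous_on_subset[OF g_cont]) auto
    also have "integral {0..?t} (\<lambda>s. g z s - g w s) = J z ?t - J w ?t"
      unfolding J_def
      by (intro integral_diff integrable_continuous_real continuous_on_subset[OF g_cont]) auto
    finally have "norm (J z ?t - J w ?t) \<le> dist z w / 2 * exp (2 * L * ?t)" using L by simp
    moreover have "P z t - P w t = exp (- 2 * L * ?t) *\<^sub>R (J z ?t - J w ?t)"
      by (simp add: P_def algebra_simps)
    ultimately have "norm (P z t - P w t) \<le> exp (- 2 * L * ?t) * (dist z w / 2 * exp (2 * L * ?t))"
      by simp
    also have "\<dots> = dist z w / 2" by (simp add: exp_minus)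
    finally have "norm (P z t - P w t) \<le> dist z w / 2" .
    then show "dist (Bcontfun (P z) t) (Bcontfun (P w) t) \<le> 1 / 2 * dist z w"
      by (simp add: Bcontfun_inverse[OF P_bcontfun] dist_norm)
  qed
  have "\<exists>!z. Bcontfun (P z) = z"
    by (rule banach_fix_type[of "1 / 2"]) (use contraction in auto)
  then obtain z where "Bcontfun (P z) = z" by blast
  then have z: "z t = P z t" for t
    by (metis Bcontfun_inverse P_bcontfun)
  define y where "y t = v + J z t" for t
  have y: "y t = exp (2 * L * t) *\<^sub>R z t" if "0 \<le> t" for t
    using that by (simp add: y_def z P_def flip: exp_add)
  show thesis
  proof
    show "y 0 = v" by (simp add: y_def J_def)
    have "(y has_vector_derivative F t (y t)) (at t within {0..})" if "0 \<le> t" for t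
      using J_deriv[OF that, of z] that unfolding y_def[abs_def]
      by (auto intro!: derivative_eq_intros simp: g_def y[symmetric, OF that, unfolded y_def])
    then show "solves_ode y F" by (simp add: solves_ode_def)
  qed
qed

lemma solves_ode_subinterval:
  assumes "solves_ode y F" "0 \<le> a" "s \<in> {a..b}"
  shows "(y has_vector_derivative F s (y s)) (at s within {a..b})"
proof (rule has_vector_derivative_within_subset)
  show "(y has_vector_derivative F s (y s)) (at s within {0..})"
    using assms by (simp add: solves_ode_def)
qed (use assms in auto)

lemma lipschitz_field_solutions_growth:
  fixes F :: "real \<Rightarrow> 'a::euclidean_space \<Rightarrow> 'a"
  assumes F: "lipschitz_field L F" and y: "solves_ode y F" "solves_ode y' F" and "0 \<le> a" "a \<le> b"
  shows "norm (y b - y' b) \<le> exp (L * (b - a)) * norm (y a - y' a)"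
    and "norm (y a - y' a) \<le> exp (L * (b - a)) * norm (y b - y' b)"
proof -
  have d: "((\<lambda>s. y s - y' s) has_vector_derivative F s (y s) - F s (y' s)) (at s within {a..b})"
    if "s \<in> {a..b}" for s
    by (intro has_vector_derivative_diff solves_ode_subinterval[OF y(1) \<open>0 \<le> a\<close> that]
        solves_ode_subinterval[OF y(2) \<open>0 \<le> a\<close> that])
  have le: "norm (F s (y s) - F s (y' s)) \<le> L * norm (y s - y' s)" if "s \<in> {a..b}" for s
    using F that \<open>0 \<le> a\<close> by (auto simp: lipschitz_field_def)
  show "norm (y b - y' b) \<le> exp (L * (b - a)) * norm (y a - y' a)"
    by (rule norm_growth_two_sided(1)[OF \<open>a \<le> b\<close> d le])
  show "norm (y a - y' a) \<le> exp (L * (b - a)) * norm (y b - y' b)"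
    by (rule norm_growth_two_sided(2)[OF \<open>a \<le> b\<close> d le])
qed

lemma lipschitz_field_solution_unique:
  fixes F :: "real \<Rightarrow> 'a::euclidean_space \<Rightarrow> 'a"
  assumes F: "lipschitz_field L F" and y: "solves_ode y F" "solves_ode y' F"
    and "y \<tau> = y' \<tau>" "0 \<le> \<tau>" "0 \<le> t"
  shows "y t = y' t"
proof (cases "t \<le> \<tau>")
  case True
  then show ?thesis using lipschitz_field_solutions_growth(2)[OF F y, of t \<tau>] assms by simp
next
  case False
  then show ?thesis using lipschitz_field_solutions_growth(1)[OF F y, of \<tau> t] assms by simp
qed

text \<open>The solution through \<open>(\<tau>, v)\<close> is first needed on \<open>{0..\<tau>}\<close>.  It is obtained there as a forward solution
  \<open>w\<close> of the time-reflected equation.  Its endpoint \<open>w \<tau>\<close> is the initial value at time \<open>0\<close> of the required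
  solution, which must agree with the reflection of \<open>w\<close> by the growth estimate.\<close>

lemma lipschitz_field_ivp:
  fixes F :: "real \<Rightarrow> 'a::euclidean_space \<Rightarrow> 'a"
  assumes F: "lipschitz_field L F" and "0 \<le> \<tau>"
  obtains y where "solves_ode y F" "y \<tau> = v"
proof -
  \<comment> \<open>The clamp makes the reflected field defined, with the same Lipschitz constant, after time \<open>\<tau>\<close>.\<close>
  define R where "R s w = - F (max 0 (\<tau> - s)) w" for s w
  have "continuous_on ({0..} \<times> UNIV) (\<lambda>p::real \<times> 'a. F (max 0 (\<tau> - fst p)) (snd p))"
    by (intro lipschitz_field_continuous_compose[OF F] continuous_intros) auto
  then have "lipschitz_field L R"
    using F unfolding lipschitz_field_def R_def
    by (auto simp: case_prod_unfold norm_minus_commute intro!: continuous_intros)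
      (metis max.cobounded1)
  then obtain w where w: "solves_ode w R" "w 0 = v"
    by (rule lipschitz_field_ivp_forward)
  obtain y where y: "solves_ode y F" "y 0 = w \<tau>"
    using F by (rule lipschitz_field_ivp_forward)
  have reflect: "((\<lambda>t. w (\<tau> - t)) has_vector_derivative F s (w (\<tau> - s))) (at s within {0..\<tau>})"
    if s: "s \<in> {0..\<tau>}" for s
  proof -
    have "(w has_vector_derivative R (\<tau> - s) (w (\<tau> - s))) (at (\<tau> - s) within (\<lambda>t. \<tau> - t) ` {0..\<tau>})"
      using solves_ode_subinterval[OF w(1), of 0 "\<tau> - s" \<tau>] s by auto
    then have "((w \<circ> (\<lambda>t. \<tau> - t)) has_vector_derivative (-1) *\<^sub>R R (\<tau> - s) (w (\<tau> - s))) (at s within {0..\<tau>})"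
      by (intro vector_diff_chain_within) (auto intro!: derivative_eq_intros)
    then show ?thesis using s by (simp add: R_def o_def)
  qed
  have "norm (y \<tau> - w (\<tau> - \<tau>)) \<le> exp (L * (\<tau> - 0)) * norm (y 0 - w (\<tau> - 0))"
  proof (rule norm_growth_two_sided(1)[OF \<open>0 \<le> \<tau>\<close>])
    fix s assume s: "s \<in> {0..\<tau>}"
    show "((\<lambda>s. y s - w (\<tau> - s)) has_vector_derivative F s (y s) - F s (w (\<tau> - s))) (at s within {0..\<tau>})"
      by (intro has_vector_derivative_diff solves_ode_subinterval[OF y(1) order_refl s] reflect[OF s])
    show "norm (F s (y s) - F s (w (\<tau> - s))) \<le> L * norm (y s - w (\<tau> - s))"
      using F s by (auto simp: lipschitz_field_def)
  qed
  then have "y \<tau> = v" using y w by simp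
  then show thesis using that y(1) by blast
qed

section \<open>Transfer between two flows with common values at time zero\<close>

text \<open>For a Lipschitz field the choice is immaterial on \<open>{0..}\<close>, where the solution is unique.\<close>

definition flow :: "(real \<Rightarrow> 'a::real_normed_vector \<Rightarrow> 'a) \<Rightarrow> real \<Rightarrow> 'a \<Rightarrow> real \<Rightarrow> 'a" where
  "flow F \<tau> v = (SOME y. solves_ode y F \<and> y \<tau> = v)"

lemma
  fixes F :: "real \<Rightarrow> 'a::euclidean_space \<Rightarrow> 'a"
  assumes F: "lipschitz_field L F" and "0 \<le> \<tau>"
  shows flow_solves: "solves_ode (flow F \<tau> v) F"
    and flow_initial: "flow F \<tau> v \<tau> = v"
proof -
  obtain y where "solves_ode y F \<and> y \<tau> = v"
    using lipschitz_field_ivp[OF assms] by blast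
  then have "solves_ode (flow F \<tau> v) F \<and> flow F \<tau> v \<tau> = v"
    unfolding flow_def by (rule someI[where P = "\<lambda>y. solves_ode y F \<and> y \<tau> = v"])
  then show "solves_ode (flow F \<tau> v) F" "flow F \<tau> v \<tau> = v" by auto
qed

lemma flow_eq:
  fixes F :: "real \<Rightarrow> 'a::euclidean_space \<Rightarrow> 'a"
  assumes F: "lipschitz_field L F" and "0 \<le> \<tau>" "0 \<le> t" and y: "solves_ode y F"
  shows "flow F \<tau> (y \<tau>) t = y t"
  by (rule lipschitz_field_solution_unique[OF F flow_solves[OF F \<open>0 \<le> \<tau>\<close>] y
        flow_initial[OF F \<open>0 \<le> \<tau>\<close>] \<open>0 \<le> \<tau>\<close> \<open>0 \<le> t\<close>])

definition transfer ::
    "(real \<Rightarrow> 'a::real_normed_vector \<Rightarrow> 'a) \<Rightarrow> (real \<Rightarrow> 'a \<Rightarrow> 'a) \<Rightarrow> real \<Rightarrow> 'a \<Rightarrow> 'a" where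
  "transfer F F' t u = flow F' 0 (flow F t u 0) t"

lemma transfer_solution:
  fixes F F' :: "real \<Rightarrow> 'a::euclidean_space \<Rightarrow> 'a"
  assumes F: "lipschitz_field L F" and x: "solves_ode x F" and "0 \<le> t"
  shows "transfer F F' t (x t) = flow F' 0 (x 0) t"
  using flow_eq[OF F \<open>0 \<le> t\<close> _ x, of 0] by (simp add: transfer_def)

lemma transfer_solves:
  fixes F F' :: "real \<Rightarrow> 'a::euclidean_space \<Rightarrow> 'a"
  assumes F: "lipschitz_field L F" and F': "lipschitz_field L' F'" and x: "solves_ode x F"
  shows "solves_ode (\<lambda>t. transfer F F' t (x t)) F'"
proof -
  have sol: "solves_ode (flow F' 0 (x 0)) F'" by (rule flow_solves[OF F']) simp
  have eq: "transfer F F' t (x t) = flow F' 0 (x 0) t" if "0 \<le> t" for t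
    using transfer_solution[OF F x that] .
  show ?thesis
    unfolding solves_ode_def
  proof (intro allI impI)
    fix t :: real assume t: "0 \<le> t"
    have "(flow F' 0 (x 0) has_vector_derivative F' t (transfer F F' t (x t))) (at t within {0..})"
      using sol t by (simp add: solves_ode_def eq)
    then show "((\<lambda>t. transfer F F' t (x t)) has_vector_derivative F' t (transfer F F' t (x t))) (at t within {0..})"
      by (rule has_vector_derivative_transform[rotated 2]) (use t eq in auto)
  qed
qed

lemma transfer_inverse:
  fixes F F' :: "real \<Rightarrow> 'a::euclidean_space \<Rightarrow> 'a"
  assumes F: "lipschitz_field L F" and F': "lipschitz_field L' F'" and "0 \<le> t"
  shows "transfer F' F t (transfer F F' t u) = u"
proof -
  let ?y = "flow F' 0 (flow F t u 0)"
  have "transfer F' F t (?y t) = flow F 0 (?y 0) t"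
    by (rule transfer_solution[OF F' flow_solves[OF F' order_refl] \<open>0 \<le> t\<close>])
  also have "\<dots> = flow F 0 (flow F t u 0) t" by (simp add: flow_initial[OF F'])
  also have "\<dots> = flow F t u t"
    by (rule flow_eq[OF F order_refl \<open>0 \<le> t\<close> flow_solves[OF F \<open>0 \<le> t\<close>]])
  also have "\<dots> = u" by (rule flow_initial[OF F \<open>0 \<le> t\<close>])
  finally show ?thesis by (simp add: transfer_def)
qed

lemma transfer_near_identity:
  fixes F F' :: "real \<Rightarrow> 'a::euclidean_space \<Rightarrow> 'a"
  assumes F: "lipschitz_field L F" and F': "lipschitz_field L' F'" and "0 \<le> t"
    and close: "\<And>x y t. solves_ode x F \<Longrightarrow> solves_ode y F' \<Longrightarrow> x 0 = y 0 \<Longrightarrow> 0 \<le> t \<Longrightarrow> N (y t - x t) \<le> B"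
  shows "N (transfer F F' t u - u) \<le> B"
proof -
  have "N (flow F' 0 (flow F t u 0) t - flow F t u t) \<le> B"
    by (rule close[OF flow_solves[OF F \<open>0 \<le> t\<close>] flow_solves[OF F'] _ \<open>0 \<le> t\<close>])
      (simp_all add: flow_initial[OF F'])
  then show ?thesis by (simp add: transfer_def flow_initial[OF F \<open>0 \<le> t\<close>])
qed

text \<open>Follow the two source solutions back by a time of at most \<open>T\<close>, pass to the target solutions at an
  error of at most \<open>2 * B\<close>, and come back with the contraction of the target flow.  Choosing \<open>T\<close> large
  makes the contracted error \<open>2 * B\<close> small; only then is \<open>\<delta>\<close> chosen, to absorb the factor \<open>exp (L * T)\<close>.
  For \<open>t \<le> T\<close> one goes back to time \<open>0\<close>, where source and target coincide and there is no such error.\<close>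

lemma transfer_equicontinuous:
  fixes F F' :: "real \<Rightarrow> 'a::euclidean_space \<Rightarrow> 'a"
  assumes F: "lipschitz_field L F" and F': "lipschitz_field L' F'"
    and close: "\<And>x y t. solves_ode x F \<Longrightarrow> solves_ode y F' \<Longrightarrow> x 0 = y 0 \<Longrightarrow> 0 \<le> t \<Longrightarrow> norm (y t - x t) \<le> B"
    and contract: "\<And>y y' s t. solves_ode y F' \<Longrightarrow> solves_ode y' F' \<Longrightarrow> 0 \<le> s \<Longrightarrow> s \<le> t \<Longrightarrow>
        norm (y t - y' t) \<le> C * exp (- \<beta> * (t - s)) * norm (y s - y' s)"
    and "0 < \<beta>" "0 < C" "0 < \<epsilon>"
  shows "\<exists>\<delta>>0. \<forall>t\<ge>0. \<forall>u v. norm (u - v) < \<delta> \<longrightarrow> norm (transfer F F' t u - transfer F F' t v) < \<epsilon>"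
proof -
  have L: "0 < L" using F by (simp add: lipschitz_field_def)
  have B: "0 \<le> B"
  proof -
    have "norm (flow F' 0 0 0 - flow F 0 0 0) \<le> B"
      by (rule close[OF flow_solves[OF F] flow_solves[OF F']])
        (simp_all add: flow_initial[OF F] flow_initial[OF F'])
    then show ?thesis using norm_ge_zero order_trans by blast
  qed
  \<comment> \<open>\<open>exp r > r - 1\<close>, so a contraction by \<open>exp (- r)\<close> brings \<open>2 * C * B\<close> below \<open>\<epsilon> / 2\<close>.\<close>
  define r where "r = 4 * C * B / \<epsilon> + 1"
  define T where "T = r / \<beta>"
  have r: "0 < r" using B \<open>0 < C\<close> \<open>0 < \<epsilon>\<close> unfolding r_def by (intro add_nonneg_pos) auto
  then have "0 < T" using \<open>0 < \<beta>\<close> by (simp add: T_def)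
  have "4 * C * B / \<epsilon> < exp r" using exp_ge_add_one_self[of r] by (simp add: r_def)
  then have "C * (2 * B) / exp r < \<epsilon> / 2" using \<open>0 < \<epsilon>\<close> by (simp add: field_simps)
  moreover have "exp (- \<beta> * T) = 1 / exp r"
    using \<open>0 < \<beta>\<close> by (simp add: T_def exp_minus inverse_eq_divide)
  ultimately have T: "C * exp (- \<beta> * T) * (2 * B) < \<epsilon> / 2" by simp
  define \<delta> where "\<delta> = \<epsilon> / (2 * C * exp (L * T))"
  have \<delta>: "\<delta> > 0" "C * (exp (L * T) * \<delta>) = \<epsilon> / 2"
    using \<open>0 < C\<close> \<open>0 < \<epsilon>\<close> by (auto simp: \<delta>_def)
  show ?thesis
  proof (intro exI[of _ \<delta>] conjI allI impI \<delta>(1))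
    fix t :: real and u v :: 'a
    assume t: "0 \<le> t" and uv: "norm (u - v) < \<delta>"
    define s where "s = max 0 (t - T)"
    have s: "0 \<le> s" "s \<le> t" "t - s \<le> T" using t \<open>0 < T\<close> by (auto simp: s_def)
    let ?x = "flow F t u" and ?x' = "flow F t v"
    let ?y = "flow F' 0 (?x 0)" and ?y' = "flow F' 0 (?x' 0)"
    have x: "solves_ode ?x F" "solves_ode ?x' F" using flow_solves[OF F t] by blast+
    have y: "solves_ode ?y F'" "solves_ode ?y' F'" using flow_solves[OF F' order_refl] by blast+
    have y0: "?y 0 = ?x 0" "?y' 0 = ?x' 0" using flow_initial[OF F' order_refl] by blast+
    have "norm (?x s - ?x' s) \<le> exp (L * (t - s)) * norm (?x t - ?x' t)"
      using lipschitz_field_solutions_growth(2)[OF F x s(1,2)] .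
    also have "\<dots> \<le> exp (L * T) * \<delta>"
      using uv s L flow_initial[OF F t] by (intro mult_mono) auto
    finally have xs: "norm (?x s - ?x' s) \<le> exp (L * T) * \<delta>" .
    have "norm (?y t - ?y' t) < \<epsilon>"
    proof (cases "t \<le> T")
      case True
      then have "s = 0" by (simp add: s_def)
      have "norm (?y t - ?y' t) \<le> C * exp (- \<beta> * (t - s)) * norm (?y s - ?y' s)"
        using contract[OF y s(1,2)] .
      also have "\<dots> \<le> C * 1 * (exp (L * T) * \<delta>)"
        using xs \<open>0 < C\<close> \<open>0 < \<beta>\<close> t y0 \<open>s = 0\<close> by (intro mult_mono) auto
      also have "\<dots> < \<epsilon>" using \<delta> \<open>0 < \<epsilon>\<close> by simp
      finally show ?thesis .
    next
      case False
      then have ts: "t - s = T" by (simp add: s_def)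
      have "norm (?y s - ?y' s) \<le> norm (?y s - ?x s) + norm (?x s - ?x' s) + norm (?y' s - ?x' s)"
        using norm_triangle_ineq4[of "(?y s - ?x s) + (?x s - ?x' s)" "?y' s - ?x' s"]
          norm_triangle_ineq[of "?y s - ?x s" "?x s - ?x' s"] by (simp add: algebra_simps)
      also have "\<dots> \<le> 2 * B + exp (L * T) * \<delta>"
        using close[OF x(1) y(1) y0(1)[symmetric] s(1)] close[OF x(2) y(2) y0(2)[symmetric] s(1)] xs by simp
      finally have ys: "norm (?y s - ?y' s) \<le> 2 * B + exp (L * T) * \<delta>" .
      have "norm (?y t - ?y' t) \<le> C * exp (- \<beta> * T) * norm (?y s - ?y' s)"
        using contract[OF y s(1,2)] ts by simp
      also have "\<dots> \<le> C * exp (- \<beta> * T) * (2 * B + exp (L * T) * \<delta>)"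
        using ys \<open>0 < C\<close> by (intro mult_left_mono) auto
      also have "\<dots> \<le> C * exp (- \<beta> * T) * (2 * B) + C * 1 * (exp (L * T) * \<delta>)"
        unfolding distrib_left using \<delta>(1) \<open>0 < C\<close> \<open>0 < \<beta>\<close> \<open>0 < T\<close>
        by (intro add_left_mono mult_right_mono mult_left_mono) auto
      also have "\<dots> < \<epsilon>" using T \<delta>(2) by simp
      finally show ?thesis .
    qed
    then show "norm (transfer F F' t u - transfer F F' t v) < \<epsilon>" by (simp add: transfer_def)
  qed
qed

section \<open>Linear systems and their transition matrices\<close>

lemma bounded_bilinear_matrix_vector_mult:
  "bounded_bilinear ((*v) :: real^'n^'m \<Rightarrow> real^'n \<Rightarrow> real^'m)"
  unfolding bilinear_conv_bounded_bilinear[symmetric] bilinear_def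
  by (auto intro!: linearI
      simp: matrix_vector_mult_add_rdistrib matrix_vector_mult_scaleR matrix_vector_right_distrib
        scaleR_matrix_vector_assoc)

lemma bounded_bilinear_matrix_matrix_mult:
  "bounded_bilinear ((**) :: real^'n^'m \<Rightarrow> real^'p^'n \<Rightarrow> real^'p^'m)"
  unfolding bilinear_conv_bounded_bilinear[symmetric] bilinear_def
  by (auto intro!: linearI
      simp: matrix_matrix_mult_def vec_eq_iff sum.distrib sum_distrib_left algebra_simps)

lemma lipschitz_field_bilinear:
  fixes b :: "'b::real_normed_vector \<Rightarrow> 'a::euclidean_space \<Rightarrow> 'a"
  assumes b: "bounded_bilinear b" and A: "continuous_on {0..} A"
    and a: "\<And>t. 0 \<le> t \<Longrightarrow> norm (A t) \<le> a"
  obtains L where "lipschitz_field L (\<lambda>t x. b (A t) x)"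
proof -
  interpret bounded_bilinear b by (rule b)
  obtain k where k: "0 < k" "\<And>x y. norm (b x y) \<le> norm x * norm y * k"
    using pos_bounded by blast
  have a0: "0 \<le> a" using a[of 0] norm_ge_zero[of "A 0"] by linarith
  have "lipschitz_field (a * k + 1) (\<lambda>t x. b (A t) x)"
    unfolding lipschitz_field_def
  proof (intro conjI allI impI)
    show "0 < a * k + 1" using a0 k(1) by (simp add: add_nonneg_pos)
    have "continuous_on ({0..} \<times> UNIV) (\<lambda>p::real \<times> 'a. b (A (fst p)) (snd p))"
      by (intro continuous_on continuous_on_compose2[OF A] continuous_intros) auto
    then show "continuous_on ({0..} \<times> UNIV) (\<lambda>(t, y). b (A t) y)" by (simp add: case_prod_unfold)
    show "\<exists>m. \<forall>t\<ge>0. norm (b (A t) 0) \<le> m" by (auto simp: zero_right)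
    fix t :: real and y y' :: 'a assume "0 \<le> t"
    have "norm (b (A t) y - b (A t) y') \<le> norm (A t) * norm (y - y') * k"
      using k(2)[of "A t" "y - y'"] by (simp add: diff_right)
    also have "\<dots> \<le> a * norm (y - y') * k"
      using k(1) a[OF \<open>0 \<le> t\<close>] by (intro mult_right_mono) auto
    also have "\<dots> \<le> (a * k + 1) * norm (y - y')" by (simp add: algebra_simps)
    finally show "norm (b (A t) y - b (A t) y') \<le> (a * k + 1) * norm (y - y')" .
  qed
  then show thesis using that by blast
qed

lemma lipschitz_field_add:
  fixes F f :: "real \<Rightarrow> 'a::euclidean_space \<Rightarrow> 'a"
  assumes F: "lipschitz_field L F" and f: "lipschitz_field l f"
  shows "lipschitz_field (L + l) (\<lambda>t y. F t y + f t y)"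
  unfolding lipschitz_field_def
proof (intro conjI allI impI)
  show "0 < L + l" using F f by (simp add: lipschitz_field_def)
  show "continuous_on ({0..} \<times> UNIV) (\<lambda>(t, y). F t y + f t y)"
    using F f unfolding lipschitz_field_def case_prod_unfold by (intro continuous_on_add) auto
  obtain m k where "\<And>t. 0 \<le> t \<Longrightarrow> norm (F t 0) \<le> m" "\<And>t. 0 \<le> t \<Longrightarrow> norm (f t 0) \<le> k"
    using F f unfolding lipschitz_field_def by blast
  then show "\<exists>m. \<forall>t\<ge>0. norm (F t 0 + f t 0) \<le> m"
    by (intro exI[of _ "m + k"]) (auto intro: norm_triangle_mono)
  fix t :: real and y y' :: 'a assume "0 \<le> t"
  then have "norm (F t y - F t y') \<le> L * norm (y - y')" "norm (f t y - f t y') \<le> l * norm (y - y')"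
    using F f unfolding lipschitz_field_def by blast+
  then have "norm ((F t y - F t y') + (f t y - f t y')) \<le> L * norm (y - y') + l * norm (y - y')"
    by (rule norm_triangle_mono)
  then show "norm (F t y + f t y - (F t y' + f t y')) \<le> (L + l) * norm (y - y')"
    by (simp add: algebra_simps)
qed

text \<open>Variation of constants differentiates \<open>\<Phi> t s\<close> in its second argument, about which the definition of a
  transition matrix says nothing.  The solution \<open>\<Psi>\<close> of the adjoint equation supplies this derivative:
  \<open>\<Psi> t ** \<Phi> t 0\<close> has derivative zero, so \<open>\<Psi> s\<close> is the inverse of \<open>\<Phi> s 0\<close>, and uniqueness identifies
  \<open>\<Phi> t 0 ** \<Psi> s\<close> with \<open>\<Phi> t s\<close>.\<close>

lemma transition_matrix_factorization:
  fixes A :: "real \<Rightarrow> real^'n^'n"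
  assumes A: "continuous_on {0..} A" and a: "\<And>t. 0 \<le> t \<Longrightarrow> norm (A t) \<le> a"
    and \<Phi>: "transition_matrix A \<Phi>"
  obtains \<Psi> where "solves_ode \<Psi> (\<lambda>t X. X ** (- A t))"
    "\<And>s t. 0 \<le> s \<Longrightarrow> 0 \<le> t \<Longrightarrow> \<Phi> t s = \<Phi> t 0 ** \<Psi> s"
proof -
  note bil = bounded_bilinear_matrix_matrix_mult
  obtain L where L: "lipschitz_field L (\<lambda>t X. A t ** X :: real^'n^'n)"
    using lipschitz_field_bilinear[OF bil A a] by blast
  have "continuous_on {0..} (\<lambda>t. - A t)" "\<And>t. 0 \<le> t \<Longrightarrow> norm (- A t) \<le> a"
    using A a by (auto intro: continuous_intros)
  then obtain L' where L': "lipschitz_field L' (\<lambda>t X. X ** (- A t) :: real^'n^'n)"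
    using lipschitz_field_bilinear[OF bounded_bilinear.flip[OF bil]] by blast
  obtain \<Psi> where \<Psi>: "solves_ode \<Psi> (\<lambda>t X. X ** (- A t))" "\<Psi> 0 = mat 1"
    using lipschitz_field_ivp_forward[OF L'] by blast
  have \<Phi>_sol: "solves_ode (\<lambda>t. \<Phi> t s) (\<lambda>t X. A t ** X)" and \<Phi>_init: "\<Phi> s s = mat 1"
    if "0 \<le> s" for s
    using \<Phi> that by (auto simp: transition_matrix_def)
  have inverse: "\<Psi> s ** \<Phi> s 0 = mat 1" if "0 \<le> s" for s
  proof -
    have "((\<lambda>t. \<Psi> t ** \<Phi> t 0) has_vector_derivative 0) (at t within {0..})" if "t \<in> {0..}" for t
    proof -
      have "((\<lambda>t. \<Psi> t ** \<Phi> t 0) has_vector_derivative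
          \<Psi> t ** (A t ** \<Phi> t 0) + \<Psi> t ** (- A t) ** \<Phi> t 0) (at t within {0..})"
        using \<Psi>(1) \<Phi>_sol[of 0] that unfolding solves_ode_def
        by (intro bounded_bilinear.has_vector_derivative[OF bil]) auto
      moreover have "\<Psi> t ** (A t ** \<Phi> t 0) + \<Psi> t ** (- A t) ** \<Phi> t 0 = 0"
        by (simp add: matrix_mul_assoc bounded_bilinear.minus_right[OF bil] bounded_bilinear.minus_left[OF bil])
      ultimately show ?thesis by simp
    qed
    then obtain c where "\<And>t. t \<in> {0..} \<Longrightarrow> \<Psi> t ** \<Phi> t 0 = c"
      using has_vector_derivative_zero_constant[of "{0::real..}" "\<lambda>t. \<Psi> t ** \<Phi> t 0"] by auto
    then show ?thesis using \<Psi>(2) \<Phi>_init[of 0] that by (metis atLeast_iff matrix_mul_lid order_refl)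
  qed
  have "\<Phi> t s = \<Phi> t 0 ** \<Psi> s" if "0 \<le> s" "0 \<le> t" for s t
  proof (rule lipschitz_field_solution_unique[OF L, where y = "\<lambda>t. \<Phi> t s" and y' = "\<lambda>t. \<Phi> t 0 ** \<Psi> s" and \<tau> = s])
    show "solves_ode (\<lambda>t. \<Phi> t s) (\<lambda>t X. A t ** X)" using that by (intro \<Phi>_sol)
    have "((\<lambda>t. \<Phi> t 0 ** \<Psi> s) has_vector_derivative A t ** \<Phi> t 0 ** \<Psi> s) (at t within {0..})"
      if "0 \<le> t" for t
      using \<Phi>_sol[of 0] that unfolding solves_ode_def
      by (intro bounded_linear.has_vector_derivative[OF bounded_bilinear.bounded_linear_left[OF bil]]) auto
    then show "solves_ode (\<lambda>t. \<Phi> t 0 ** \<Psi> s) (\<lambda>t X. A t ** X)"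
      by (simp add: solves_ode_def matrix_mul_assoc)
    show "\<Phi> s s = \<Phi> s 0 ** \<Psi> s"
      using matrix_left_right_inverse inverse[OF \<open>0 \<le> s\<close>] \<Phi>_init[OF \<open>0 \<le> s\<close>] by metis
  qed (use that in auto)
  then show thesis using that[OF \<Psi>(1)] by blast
qed

section \<open>Perturbations of a uniformly asymptotically stable system\<close>

text \<open>Stability is stated for vectors, which is how a compatible matrix norm enters the estimates.  The
  bound \<open>a\<close> on the coefficients is Euclidean: it only serves to make the linear equation Lipschitz.\<close>

locale uniformly_stable_system =
  fixes N :: "real^'n \<Rightarrow> real" and A :: "real \<Rightarrow> real^'n^'n"
    and \<Phi> :: "real \<Rightarrow> real \<Rightarrow> real^'n^'n" and a K \<alpha> :: real
  assumes N: "is_norm N"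
    and A_continuous: "continuous_on {0..} A"
    and A_bounded: "0 \<le> t \<Longrightarrow> norm (A t) \<le> a"
    and transition: "transition_matrix A \<Phi>"
    and K: "1 \<le> K" and \<alpha>: "0 < \<alpha>"
    and stable: "0 \<le> s \<Longrightarrow> s \<le> t \<Longrightarrow> N (\<Phi> t s *v x) \<le> K * exp (- \<alpha> * (t - s)) * N x"
begin

text \<open>The function \<open>\<lambda>r. \<Phi> t r *v d r\<close> joins \<open>\<Phi> t s *v d s\<close> to \<open>d t\<close> and has derivative \<open>\<Phi> t r *v h r\<close>, so the mean
  value inequality for \<open>N\<close> replaces a bound on the norm of a vector-valued integral; \<open>g\<close> is an
  antiderivative of a bound on the integrand.\<close>

lemma variation_of_constants_estimate:
  assumes "0 \<le> s" "s \<le> t"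
    and d: "solves_ode d (\<lambda>r x. A r *v x + h r)"
    and g: "\<And>r. r \<in> {s..t} \<Longrightarrow> (g has_real_derivative g' r) (at r within {s..t})"
    and le: "\<And>r. r \<in> {s..t} \<Longrightarrow> K * exp (- \<alpha> * (t - r)) * N (h r) \<le> g' r"
  shows "N (d t) \<le> K * exp (- \<alpha> * (t - s)) * N (d s) + (g t - g s)"
proof -
  note bil = bounded_bilinear_matrix_vector_mult
  obtain \<Psi> where \<Psi>: "solves_ode \<Psi> (\<lambda>t X. X ** (- A t))"
    and \<Phi>: "\<And>s t. 0 \<le> s \<Longrightarrow> 0 \<le> t \<Longrightarrow> \<Phi> t s = \<Phi> t 0 ** \<Psi> s"
    using transition_matrix_factorization[OF A_continuous A_bounded transition] by blast
  define p where "p r = \<Phi> t 0 *v (\<Psi> r *v d r)" for r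
  have p: "p r = \<Phi> t r *v d r" if "0 \<le> r" for r
    using \<Phi>[of r t] that assms(1,2) by (simp add: p_def matrix_vector_mul_assoc)
  have "N (p t - p s) \<le> g t - g s"
  proof (rule is_norm_mean_value[OF N \<open>s \<le> t\<close> _ g])
    fix r assume r: "r \<in> {s..t}"
    have "(\<Psi> has_vector_derivative \<Psi> r ** (- A r)) (at r within {s..t})"
      and "(d has_vector_derivative A r *v d r + h r) (at r within {s..t})"
      using solves_ode_subinterval[OF \<Psi> \<open>0 \<le> s\<close> r] solves_ode_subinterval[OF d \<open>0 \<le> s\<close> r] by auto
    then have "(p has_vector_derivative
        \<Phi> t 0 *v (\<Psi> r *v (A r *v d r + h r) + (\<Psi> r ** (- A r)) *v d r)) (at r within {s..t})"
      unfolding p_def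
      by (intro bounded_linear.has_vector_derivative[OF bounded_bilinear.bounded_linear_right[OF bil]]
          bounded_bilinear.has_vector_derivative[OF bil])
    moreover have "\<Psi> r *v (A r *v d r + h r) + (\<Psi> r ** (- A r)) *v d r = \<Psi> r *v h r"
      by (simp add: matrix_vector_mul_assoc[symmetric] bounded_bilinear.minus_right[OF bil]
          bounded_bilinear.minus_left[OF bil] matrix_vector_right_distrib)
    moreover have "\<Phi> t 0 *v (\<Psi> r *v h r) = \<Phi> t r *v h r"
      using \<Phi>[of r t] r assms(1,2) by (simp add: matrix_vector_mul_assoc)
    ultimately show "(p has_vector_derivative \<Phi> t r *v h r) (at r within {s..t})" by simp
    show "N (\<Phi> t r *v h r) \<le> g' r"
      using stable[of r t "h r"] le[OF r] r \<open>0 \<le> s\<close> by auto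
  qed
  moreover have "p t = d t"
    using p[of t] transition assms(1,2) by (simp add: transition_matrix_def)
  moreover have "N (p s) \<le> K * exp (- \<alpha> * (t - s)) * N (d s)"
    using p[of s] stable[OF assms(1,2)] assms(1) by simp
  ultimately show ?thesis using is_norm_diff_le[OF N, of "p t" "p s"] by simp
qed

text \<open>With the weight \<open>exp (\<alpha> * r)\<close> absorbed into \<open>u\<close>, variation of constants becomes the hypothesis of
  Gronwall's inequality with rate \<open>K * \<gamma>\<close>; removing the weight leaves the rate \<open>\<alpha> - K * \<gamma>\<close>.  For
  \<open>f = 0\<close> and \<open>\<gamma> = 0\<close> this is the contraction of the linear flow.\<close>

lemma perturbed_solutions_contract:
  assumes "0 \<le> s" "s \<le> t" "0 \<le> \<gamma>"
    and Lip: "\<And>r y y'. 0 \<le> r \<Longrightarrow> N (f r y - f r y') \<le> \<gamma> * N (y - y')"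
    and y: "solves_ode y (\<lambda>r x. A r *v x + f r x)" and y': "solves_ode y' (\<lambda>r x. A r *v x + f r x)"
  shows "N (y t - y' t) \<le> K * exp (- (\<alpha> - K * \<gamma>) * (t - s)) * N (y s - y' s)"
proof -
  define d where "d r = y r - y' r" for r
  define h where "h r = f r (y r) - f r (y' r)" for r
  define u where "u r = exp (\<alpha> * r) * N (d r)" for r
  have d: "solves_ode d (\<lambda>r x. A r *v x + h r)"
    unfolding solves_ode_def
  proof (intro allI impI)
    fix r :: real assume "0 \<le> r"
    then have "(d has_vector_derivative (A r *v y r + f r (y r)) - (A r *v y' r + f r (y' r))) (at r within {0..})"
      unfolding d_def using y y' by (intro has_vector_derivative_diff) (auto simp: solves_ode_def)
    then show "(d has_vector_derivative A r *v d r + h r) (at r within {0..})"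
      by (simp add: d_def h_def matrix_vector_mult_diff_distrib algebra_simps)
  qed
  have u_cont: "continuous_on {s..q} u" for q
  proof -
    have "continuous_on {s..q} d"
      by (rule continuous_on_vector_derivative[OF solves_ode_subinterval[OF d \<open>0 \<le> s\<close>]])
    then have "continuous_on {s..q} (\<lambda>r. N (d r))"
      by (rule continuous_on_compose2[OF continuous_on_is_norm[OF N, of UNIV]]) simp
    then show ?thesis unfolding u_def by (intro continuous_intros)
  qed
  have "u t \<le> K * u s * exp (K * \<gamma> * (t - s))"
  proof (rule gronwall_integral[OF \<open>s \<le> t\<close> u_cont])
    show "0 \<le> K * \<gamma>" using K \<open>0 \<le> \<gamma>\<close> by simp
    fix q assume q: "q \<in> {s..t}"
    have "N (d q) \<le> K * exp (- \<alpha> * (q - s)) * N (d s) +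
        (K * \<gamma> * exp (- \<alpha> * q) * integral {s..q} u - K * \<gamma> * exp (- \<alpha> * q) * integral {s..s} u)"
    proof (rule variation_of_constants_estimate[OF \<open>0 \<le> s\<close> _ d])
      fix r assume r: "r \<in> {s..q}"
      have "((\<lambda>r. integral {s..r} u) has_real_derivative u r) (at r within {s..q})"
        using integral_has_vector_derivative[OF u_cont r]
        by (simp add: has_real_derivative_iff_has_vector_derivative)
      then show "((\<lambda>r. K * \<gamma> * exp (- \<alpha> * q) * integral {s..r} u) has_real_derivative
          K * \<gamma> * exp (- \<alpha> * q) * u r) (at r within {s..q})"
        by (rule DERIV_cmult)
      have "K * exp (- \<alpha> * (q - r)) * N (h r) \<le> K * exp (- \<alpha> * (q - r)) * (\<gamma> * N (d r))"
        unfolding h_def d_def using r \<open>0 \<le> s\<close> K by (intro mult_left_mono Lip) auto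
      also have "\<dots> = K * \<gamma> * exp (- \<alpha> * q) * u r"
      proof -
        have "exp (- \<alpha> * (q - r)) = exp (- \<alpha> * q) * exp (\<alpha> * r)"
          by (simp add: algebra_simps flip: exp_add)
        then show ?thesis by (simp only: u_def mult_ac)
      qed
      finally show "K * exp (- \<alpha> * (q - r)) * N (h r) \<le> K * \<gamma> * exp (- \<alpha> * q) * u r" .
    qed (use q in auto)
    then have "u q \<le> exp (\<alpha> * q) * (K * exp (- \<alpha> * (q - s)) * N (d s) + K * \<gamma> * exp (- \<alpha> * q) * integral {s..q} u)"
      unfolding u_def by (intro mult_left_mono) auto
    also have "\<dots> = K * (exp (\<alpha> * q) * exp (- \<alpha> * (q - s))) * N (d s)
        + K * \<gamma> * (exp (\<alpha> * q) * exp (- \<alpha> * q)) * integral {s..q} u"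
      by (simp only: algebra_simps)
    also have "\<dots> = K * u s + K * \<gamma> * integral {s..q} u"
      unfolding exp_add[symmetric] by (simp add: u_def algebra_simps)
    finally show "u q \<le> K * u s + K * \<gamma> * integral {s..q} u" .
  qed
  then have "exp (- \<alpha> * t) * u t \<le> exp (- \<alpha> * t) * (K * u s * exp (K * \<gamma> * (t - s)))"
    by (intro mult_left_mono) auto
  also have "\<dots> = K * (exp (- \<alpha> * t) * exp (\<alpha> * s) * exp (K * \<gamma> * (t - s))) * N (d s)"
    by (simp only: u_def algebra_simps)
  also have "exp (- \<alpha> * t) * exp (\<alpha> * s) * exp (K * \<gamma> * (t - s)) = exp (- (\<alpha> - K * \<gamma>) * (t - s))"
    unfolding exp_add[symmetric] by (simp add: algebra_simps)
  also have "exp (- \<alpha> * t) * u t = N (d t)"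
    unfolding u_def mult.assoc[symmetric] exp_add[symmetric] by simp
  finally show ?thesis by (simp add: d_def)
qed

text \<open>The difference of the two solutions vanishes at time \<open>0\<close> and is driven by a forcing bounded by \<open>\<mu>\<close>;
  \<open>K * \<mu> / \<alpha>\<close> is the integral of \<open>K * \<mu> * exp (- \<alpha> * r)\<close> over the half-line.\<close>

lemma perturbed_solution_close:
  assumes "0 \<le> t"
    and bound: "\<And>r y. 0 \<le> r \<Longrightarrow> N (f r y) \<le> \<mu>"
    and x: "solves_ode x (\<lambda>r x. A r *v x)" and y: "solves_ode y (\<lambda>r x. A r *v x + f r x)"
    and "x 0 = y 0"
  shows "N (y t - x t) \<le> K * \<mu> / \<alpha>"
proof -
  have \<mu>: "0 \<le> \<mu>" using bound[of 0] is_norm_nonneg[OF N] order_trans by blast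
  have d: "solves_ode (\<lambda>r. y r - x r) (\<lambda>r x. A r *v x + f r (y r))"
    unfolding solves_ode_def
  proof (intro allI impI)
    fix r :: real assume "0 \<le> r"
    then have "((\<lambda>r. y r - x r) has_vector_derivative (A r *v y r + f r (y r)) - A r *v x r) (at r within {0..})"
      using x y by (intro has_vector_derivative_diff) (auto simp: solves_ode_def)
    then show "((\<lambda>r. y r - x r) has_vector_derivative A r *v (y r - x r) + f r (y r)) (at r within {0..})"
      by (simp add: matrix_vector_mult_diff_distrib algebra_simps)
  qed
  have "N (y t - x t) \<le> K * exp (- \<alpha> * (t - 0)) * N (y 0 - x 0) +
      (K * \<mu> / \<alpha> * exp (- \<alpha> * (t - t)) - K * \<mu> / \<alpha> * exp (- \<alpha> * (t - 0)))"
  proof (rule variation_of_constants_estimate[OF order_refl \<open>0 \<le> t\<close> d])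
    fix r assume r: "r \<in> {0..t}"
    show "((\<lambda>r. K * \<mu> / \<alpha> * exp (- \<alpha> * (t - r))) has_real_derivative K * exp (- \<alpha> * (t - r)) * \<mu>)
        (at r within {0..t})"
      by (rule derivative_eq_intros refl)+ (use \<alpha> in simp)
    show "K * exp (- \<alpha> * (t - r)) * N (f r (y r)) \<le> K * exp (- \<alpha> * (t - r)) * \<mu>"
      using bound[of r "y r"] r K by (intro mult_left_mono) auto
  qed
  also have "\<dots> \<le> K * \<mu> / \<alpha>"
    using \<open>x 0 = y 0\<close> K \<alpha> \<mu> is_norm_zero[OF N] by simp
  finally show ?thesis .
qed

end

section \<open>Strong topological equivalence\<close>

theorem theorem1:
  fixes vnorm :: "real^'n \<Rightarrow> real"
    and mnorm :: "real^'n^'n \<Rightarrow> real"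
    and A :: "real \<Rightarrow> real^'n^'n"
    and f :: "real \<Rightarrow> real^'n \<Rightarrow> real^'n"
    and \<Phi> :: "real \<Rightarrow> real \<Rightarrow> real^'n^'n"
    and M K \<alpha> \<gamma> \<mu> :: real
  assumes vnorm: "is_norm vnorm"
    and mnorm: "compatible_matrix_norm vnorm mnorm"
    and A_continuous: "continuous_on {0..} A"
    and A_bounded: "bdd_above ((\<lambda>t. mnorm (A t)) ` {0..})"
    and A_sup: "(SUP t\<in>{0..}. mnorm (A t)) = M"
    and M_pos: "M > 0"
    and transition: "transition_matrix A \<Phi>"
    and K: "K \<ge> 1"
    and \<alpha>: "\<alpha> > 0"
    and stable: "\<And>s t. 0 \<le> s \<Longrightarrow> s \<le> t \<Longrightarrow> mnorm (\<Phi> t s) \<le> K * exp (- \<alpha> * (t - s))"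
    and f_continuous: "continuous_on ({0..} \<times> UNIV) (\<lambda>(t, y). f t y)"
    and f_Lipschitz: "\<And>t y y'. 0 \<le> t \<Longrightarrow> vnorm (f t y - f t y') \<le> \<gamma> * vnorm (y - y')"
    and f_bounded: "\<And>t y. 0 \<le> t \<Longrightarrow> vnorm (f t y) \<le> \<mu>"
    and small: "K * \<gamma> / \<alpha> < 1"
  shows "strongly_topologically_equivalent vnorm (\<lambda>t x. A t *v x) (\<lambda>t y. A t *v y + f t y)"
proof -
  let ?F = "\<lambda>t x. A t *v x" and ?F' = "\<lambda>t y. A t *v y + f t y"
  note nn = is_norm_nonneg[OF vnorm]
  have mnorm_norm: "is_norm mnorm" and compat: "\<And>B x. vnorm (B *v x) \<le> mnorm B * vnorm x"
    using mnorm by (auto simp: compatible_matrix_norm_def)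
  obtain c C where c: "0 < c" "\<And>x. c * norm x \<le> vnorm x" and C: "0 < C" "\<And>x. vnorm x \<le> C * norm x"
    using is_norm_equivalent[OF vnorm] by metis
  obtain k where k: "0 < k" "\<And>B. k * norm B \<le> mnorm B"
    using is_norm_equivalent[OF mnorm_norm] by metis
  have norm_le: "norm x \<le> vnorm x / c" for x using c by (simp add: pos_le_divide_eq mult.commute)

  have A_norm: "norm (A t) \<le> M / k" if "0 \<le> t" for t
  proof -
    have "mnorm (A t) \<le> M" using cSUP_upper[OF _ A_bounded, of t] A_sup that by simp
    then show ?thesis using k(1) k(2)[of "A t"] by (simp add: pos_le_divide_eq mult.commute)
  qed
  interpret uniformly_stable_system vnorm A \<Phi> "M / k" K \<alpha>
  proof
    show "vnorm (\<Phi> t s *v x) \<le> K * exp (- \<alpha> * (t - s)) * vnorm x" if "0 \<le> s" "s \<le> t" for s t x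
      using compat[of "\<Phi> t s" x] mult_right_mono[OF stable[OF that] nn[of x]] by linarith
  qed (fact vnorm A_continuous A_norm transition K \<alpha>)+

  \<comment> \<open>The space has a nonzero vector, so the Lipschitz inequality itself forces the sign of \<open>\<gamma>\<close>.\<close>
  have \<gamma>: "0 \<le> \<gamma>"
  proof -
    obtain e :: "real^'n" where "e \<noteq> 0" using zero_neq_one by metis
    then have "0 < vnorm (e - 0)" using vnorm nn[of e] by (auto simp: is_norm_def order_less_le)
    moreover have "0 \<le> \<gamma> * vnorm (e - 0)" using f_Lipschitz[of 0 e 0] nn order_trans by blast
    ultimately show ?thesis by (simp add: zero_le_mult_iff)
  qed
  have rate: "0 < \<alpha> - K * \<gamma>" using small \<alpha> by (simp add: divide_less_eq)

  obtain L where F: "lipschitz_field L ?F"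
    using lipschitz_field_bilinear[OF bounded_bilinear_matrix_vector_mult A_continuous A_norm] by blast
  have "lipschitz_field (\<gamma> * C / c + 1) f"
    unfolding lipschitz_field_def
  proof (intro conjI allI impI exI)
    show "0 < \<gamma> * C / c + 1" using \<gamma> c C by (simp add: add_nonneg_pos)
    show "norm (f t 0) \<le> \<mu> / c" if "0 \<le> t" for t
      using norm_le[of "f t 0"] f_bounded[OF that, of 0] c(1)
      by (meson divide_right_mono order_less_imp_le order_trans)
    fix t :: real and y y' :: "real^'n" assume t: "0 \<le> t"
    have "norm (f t y - f t y') \<le> vnorm (f t y - f t y') / c" by (rule norm_le)
    also have "\<dots> \<le> \<gamma> * (C * norm (y - y')) / c"
      using f_Lipschitz[OF t, of y y'] mult_left_mono[OF C(2)[of "y - y'"] \<gamma>] c(1)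
      by (intro divide_right_mono) auto
    also have "\<dots> \<le> (\<gamma> * C / c + 1) * norm (y - y')" by (simp add: algebra_simps)
    finally show "norm (f t y - f t y') \<le> (\<gamma> * C / c + 1) * norm (y - y')" .
  qed (fact f_continuous)
  with F have F': "lipschitz_field (L + (\<gamma> * C / c + 1)) ?F'" by (rule lipschitz_field_add)

  have close: "vnorm (y t - x t) \<le> K * \<mu> / \<alpha>"
    if "solves_ode x ?F" "solves_ode y ?F'" "x 0 = y 0" "0 \<le> t" for x y t
    by (rule perturbed_solution_close[OF that(4) f_bounded that(1,2,3)])
  have euclidean: "norm (y t - y' t) \<le> (K * C / c) * exp (- \<beta> * (t - s)) * norm (y s - y' s)"
    if "vnorm (y t - y' t) \<le> K * exp (- \<beta> * (t - s)) * vnorm (y s - y' s)"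
    for y y' :: "real \<Rightarrow> real^'n" and \<beta> t s
  proof -
    have "norm (y t - y' t) \<le> vnorm (y t - y' t) / c" by (rule norm_le)
    also have "\<dots> \<le> K * exp (- \<beta> * (t - s)) * (C * norm (y s - y' s)) / c"
    proof (rule divide_right_mono)
      have "K * exp (- \<beta> * (t - s)) * vnorm (y s - y' s) \<le> K * exp (- \<beta> * (t - s)) * (C * norm (y s - y' s))"
        using K by (intro mult_left_mono C(2)) simp
      with that show "vnorm (y t - y' t) \<le> K * exp (- \<beta> * (t - s)) * (C * norm (y s - y' s))"
        by (rule order_trans)
    qed (use c(1) in simp)
    finally show ?thesis by (simp add: algebra_simps)
  qed
  have contract': "norm (y t - y' t) \<le> (K * C / c) * exp (- (\<alpha> - K * \<gamma>) * (t - s)) * norm (y s - y' s)"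
    if "solves_ode y ?F'" "solves_ode y' ?F'" "0 \<le> s" "s \<le> t" for y y' s t
    by (rule euclidean[OF perturbed_solutions_contract[OF that(3,4) \<gamma> f_Lipschitz that(1,2)]])
  have contract: "norm (x t - x' t) \<le> (K * C / c) * exp (- \<alpha> * (t - s)) * norm (x s - x' s)"
    if "solves_ode x ?F" "solves_ode x' ?F" "0 \<le> s" "s \<le> t" for x x' s t
    using euclidean[of x t x' \<alpha> s] perturbed_solutions_contract[of s t 0 "\<lambda>_ _. 0" x x'] that
      is_norm_zero[OF vnorm] by simp

  define H where "H = transfer ?F ?F'"
  define G where "G = transfer ?F' ?F"
  have KC: "0 < K * C / c" using K C c by simp
  have close_norm: "norm (y t - x t) \<le> K * \<mu> / \<alpha> / c"
    if "solves_ode x ?F" "solves_ode y ?F'" "x 0 = y 0" "0 \<le> t" for x y t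
    using norm_le[of "y t - x t"] divide_right_mono[OF close[OF that], of c] c(1) by linarith
  have H_uniform: "\<exists>\<delta>>0. \<forall>t\<ge>0. \<forall>u v. norm (u - v) < \<delta> \<longrightarrow> norm (H t u - H t v) < \<epsilon>" if "0 < \<epsilon>" for \<epsilon>
    unfolding H_def
  proof (rule transfer_equicontinuous[OF F F' _ _ rate KC that])
    show "norm (y t - x t) \<le> K * \<mu> / \<alpha> / c"
      if "solves_ode x ?F" "solves_ode y ?F'" "x 0 = y 0" "0 \<le> t" for x y t
      by (rule close_norm[OF that])
    show "norm (y t - y' t) \<le> (K * C / c) * exp (- (\<alpha> - K * \<gamma>) * (t - s)) * norm (y s - y' s)"
      if "solves_ode y ?F'" "solves_ode y' ?F'" "0 \<le> s" "s \<le> t" for y y' s t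
      by (rule contract'[OF that])
  qed
  have G_uniform: "\<exists>\<delta>>0. \<forall>t\<ge>0. \<forall>u v. norm (u - v) < \<delta> \<longrightarrow> norm (G t u - G t v) < \<epsilon>" if "0 < \<epsilon>" for \<epsilon>
    unfolding G_def
  proof (rule transfer_equicontinuous[OF F' F _ _ \<alpha> KC that])
    show "norm (x t - y t) \<le> K * \<mu> / \<alpha> / c"
      if "solves_ode y ?F'" "solves_ode x ?F" "y 0 = x 0" "0 \<le> t" for x y t
      using close_norm[OF that(2,1) that(3)[symmetric] that(4)] by (simp add: norm_minus_commute)
    show "norm (x t - x' t) \<le> (K * C / c) * exp (- \<alpha> * (t - s)) * norm (x s - x' s)"
      if "solves_ode x ?F" "solves_ode x' ?F" "0 \<le> s" "s \<le> t" for x x' s t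
      by (rule contract[OF that])
  qed

  have continuous: "continuous_on UNIV (P t)"
    if uniform: "\<And>\<epsilon>. 0 < \<epsilon> \<Longrightarrow> \<exists>\<delta>>0. \<forall>t\<ge>0. \<forall>u v. norm (u - v) < \<delta> \<longrightarrow> norm (P t u - P t v) < \<epsilon>"
      and "0 \<le> t" for P :: "real \<Rightarrow> real^'n \<Rightarrow> real^'n" and t
    unfolding continuous_on_iff dist_norm using uniform \<open>0 \<le> t\<close> by (metis UNIV_I)

  have "topological_equivalence vnorm ?F ?F' H G"
    unfolding topological_equivalence_def
  proof (intro conjI allI impI)
    show "solves_ode (\<lambda>t. H t (x t)) ?F'" if "solves_ode x ?F" for x
      unfolding H_def by (rule transfer_solves[OF F F' that])
    show "solves_ode (\<lambda>t. G t (y t)) ?F" if "solves_ode y ?F'" for y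
      unfolding G_def by (rule transfer_solves[OF F' F that])
    have "vnorm (H t u - u) \<le> K * \<mu> / \<alpha>" if "0 \<le> t" for t u
      unfolding H_def
    proof (rule transfer_near_identity[OF F F' that])
      show "vnorm (y t - x t) \<le> K * \<mu> / \<alpha>"
        if "solves_ode x ?F" "solves_ode y ?F'" "x 0 = y 0" "0 \<le> t" for x y t
        by (rule close[OF that])
    qed
    then show "\<exists>B. \<forall>t\<ge>0. \<forall>u. vnorm (H t u - u) \<le> B" by blast
    have "vnorm (G t u - u) \<le> K * \<mu> / \<alpha>" if "0 \<le> t" for t u
      unfolding G_def
    proof (rule transfer_near_identity[OF F' F that])
      show "vnorm (x t - y t) \<le> K * \<mu> / \<alpha>"
        if "solves_ode y ?F'" "solves_ode x ?F" "y 0 = x 0" "0 \<le> t" for x y t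
        using close[OF that(2,1) that(3)[symmetric] that(4)]
        by (simp add: is_norm_minus_commute[OF vnorm, of "x t"])
    qed
    then show "\<exists>B. \<forall>t\<ge>0. \<forall>u. vnorm (G t u - u) \<le> B" by blast
    show "homeomorphism UNIV UNIV (H t) (G t)" if t: "0 \<le> t" for t
    proof (rule homeomorphismI)
      show "continuous_on UNIV (H t)" "continuous_on UNIV (G t)"
        using continuous[OF H_uniform t] continuous[OF G_uniform t] by auto
      show "G t (H t u) = u" "H t (G t u) = u" for u
        unfolding H_def G_def using transfer_inverse[OF F F' t] transfer_inverse[OF F' F t] by auto
    qed auto
  qed
  moreover have "\<exists>\<delta>>0. \<forall>t\<ge>0. \<forall>u v. vnorm (u - v) < \<delta> \<longrightarrow>
      vnorm (H t u - H t v) < \<epsilon> \<and> vnorm (G t u - G t v) < \<epsilon>" if "0 < \<epsilon>" for \<epsilon>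
  proof -
    have "0 < \<epsilon> / C" using that C by simp
    then obtain \<delta>1 \<delta>2 where \<delta>: "0 < \<delta>1" "0 < \<delta>2"
      and 1: "\<And>t u v. 0 \<le> t \<Longrightarrow> norm (u - v) < \<delta>1 \<Longrightarrow> norm (H t u - H t v) < \<epsilon> / C"
      and 2: "\<And>t u v. 0 \<le> t \<Longrightarrow> norm (u - v) < \<delta>2 \<Longrightarrow> norm (G t u - G t v) < \<epsilon> / C"
      using H_uniform[of "\<epsilon> / C"] G_uniform[of "\<epsilon> / C"] by metis
    have small_vnorm: "vnorm x < \<epsilon>" if "norm x < \<epsilon> / C" for x
      using that C(1) C(2)[of x] by (simp add: pos_less_divide_eq mult.commute)
    have small_norm: "norm x < \<delta>" if "vnorm x < c * \<delta>" for x \<delta>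
    proof -
      have "c * norm x < c * \<delta>" using that c(2)[of x] by linarith
      then show ?thesis using c(1) by simp
    qed
    show ?thesis
    proof (intro exI[of _ "c * min \<delta>1 \<delta>2"] conjI allI impI)
      show "0 < c * min \<delta>1 \<delta>2" using c(1) \<delta> by simp
      fix t u v assume t: "(0::real) \<le> t" and "vnorm (u - v) < c * min \<delta>1 \<delta>2"
      then have "norm (u - v) < min \<delta>1 \<delta>2" by (intro small_norm)
      then show "vnorm (H t u - H t v) < \<epsilon>" "vnorm (G t u - G t v) < \<epsilon>"
        using small_vnorm[OF 1[OF t]] small_vnorm[OF 2[OF t]] by auto
    qed
  qed
  ultimately show ?thesis unfolding strongly_topologically_equivalent_def by blast
qed

end
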